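(* Let $\mathbf Z$ be a non-trivial solution, with values in $[0,\infty)^p$, of the distributional equation $\mathbf Z\stackrel{d}{=}\sum_{k=1}^N\mathbf A_k\mathbf Z(k)$, and let $\phi(\mathbf t)=\mathbb E e^{-\mathbf t\cdot\mathbf Z}$, $\mathbf t\in[0,\infty)^p$. Assume that $$\mathbb P\big(\forall k\in\{1,\dots,N\},\ \mathbf A_k\text{ has a positive column vector}\big)>0,$$ that $\underline m:=\operatorname{ess\,inf}N\ge2$, and that for some constant $\underline a>0$, $\min_{i,j}(\mathbf A_k)_{ij}\ge\underline a$ a.s. for all $1\le k\le\underline m$. (a) If $\mathbb P(N=\underline m)>0$, then there exists a constant $C_1>0$ such that for all $\|\mathbf t\|>0$ large enough, $$\phi(\mathbf t)\le\exp\{-C_1\|\mathbf t\|^\gamma\},$$ and for every fixed non-zero $\mathbf y\in[0,\infty)^p$ there exists a constant $C_{1,\mathbf y}>0$ such that for all $x>0$ small enough, $$\mathbb P(\mathbf y\cdot\mathbf Z\le x)\le\exp\{-C_{1,\mathbf y}x^{-\gamma/(1-\gamma)}\},$$ where $\gamma=-\log\underline m/\log(\underline a p)\in(0,1)$. (b) Suppose that for some $\varepsilon>0$ satisfying $(\underline a+\varepsilon)p\,\underline m<1$, $$\mathbb P\Big(N=\underline m,\ \max_{i,j}(\mathbf A_k)_{ij}\le\underline a+\varepsilon\text{ for all }1\le k\le\underline m\Big)>0.$$ Then there exists a constant $C_2>0$ such that for all $\|\mathbf t\|>0$ large enough, $$\phi(\mathbf t)\ge\exp\{-C_2\|\mathbf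 t\|^{\gamma(\varepsilon)}\},$$ and for every fixed $\mathbf y\in[0,\infty)^p$ there exists a constant $C_{2,\mathbf y}>0$ such that for all $x>0$ small enough, $$\mathbb P(\mathbf y\cdot\mathbf Z\le x)\ge\exp\{-C_{2,\mathbf y}x^{-\gamma(\varepsilon)/(1-\gamma(\varepsilon))}\},$$ where $\gamma(\varepsilon)=-\log\underline m/\log[(\underline a+\varepsilon)p]\in(0,1)$.
   Context: Fix an integer $p\ge1$. $N$ is a random variable with values in $\{0,1,2,\dots\}$ and $\mathbf A_1,\mathbf A_2,\dots$ are random $p\times p$ matrices with non-negative entries, on the same probability space as $N$ (arbitrary dependence allowed). A finite non-negative matrix $\mathbf B$ is strictly positive if for some positive integer $n$ all entries of $\mathbf B^n$ are positive. A positive column vector is one all of whose entries are positive. Standing assumption: $\mathbf M:=\mathbb E\sum_{k=1}^N\mathbf A_k$ has finite entries and is strictly positive with maximum-modulus eigenvalue $1$. A solution of $\mathbf Z\stackrel{d}{=}\sum_{k=1}^N\mathbf A_k\mathbf Z(k)$ is a random (column) vector $\mathbf Z$ in $[0,\infty)^p$ such that the equality in distribution holds when $\mathbf Z(1),\mathbf Z(2),\dots$ are i.i.d. copies of $\mathbf Z$ independent of $(N,\mathbf A_1,\mathbf A_2,\dots)$. It is non-trivial if it is not almost surely $\mathbf 0$. Notation: $\mathbf u\cdot\mathbf v=\sum_ju_jv_j$; $\|\mathbf t\|=\sum_j|t_j|$; $\mathbf t$ ranges over $[0,\infty)^p$.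
   Formalization: In (a), γ∈(0,1) can fail: γ=1 if a.s. all entries of A_1,…,A_m equal a and A_k=0 for m<k≤N; so 0<γ≤1 is proved, with γ=1 only in that case, and the tail bound in (a) is stated only for γ<1, where its exponent is defined. *)

theory Defs
  imports "HOL-Probability.Probability"
begin

definition nonneg_orthant :: "(real^'n) set" where
  "nonneg_orthant = {v. \<forall>i. 0 \<le> v $ i}"

definition l1_norm :: "real^'n \<Rightarrow> real" where
  "l1_norm t = (\<Sum>j\<in>UNIV. \<bar>t $ j\<bar>)"

text \<open>Matrix power with respect to \<open>**\<close>; the power \<open>^\<close> of the type class instance
  for vectors is the componentwise one.\<close>
definition mat_power :: "real^'n^'n \<Rightarrow> nat \<Rightarrow> real^'n^'n" where
  "mat_power B n = (((**) B) ^^ n) (mat 1)"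

definition strictly_positive :: "real^'n^'n \<Rightarrow> bool" where
  "strictly_positive B \<longleftrightarrow>
     (\<forall>i j. 0 \<le> B $ i $ j) \<and> (\<exists>n\<ge>1. \<forall>i j. 0 < mat_power B n $ i $ j)"

definition eigenvalues :: "real^'n^'n \<Rightarrow> complex set" where
  "eigenvalues B = {c. \<exists>v::complex^'n. v \<noteq> 0 \<and> map_matrix complex_of_real B *v v = c *s v}"

definition max_modulus_eigenvalue :: "real^'n^'n \<Rightarrow> complex \<Rightarrow> bool" where
  "max_modulus_eigenvalue B c \<longleftrightarrow>
     c \<in> eigenvalues B \<and> (\<forall>d\<in>eigenvalues B. cmod d \<le> cmod c)"

definition has_positive_column :: "real^'n^'n \<Rightarrow> bool" where
  "has_positive_column B \<longleftrightarrow> (\<exists>j. \<forall>i. 0 < column j B $ i)"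

definition mean_matrix :: "'w measure \<Rightarrow> ('w \<Rightarrow> nat) \<Rightarrow> (nat \<Rightarrow> 'w \<Rightarrow> real^'n^'n) \<Rightarrow> real^'n^'n" where
  "mean_matrix P N A = (\<chi> i j. \<integral>\<omega>. (\<Sum>k=1..N \<omega>. A k \<omega> $ i $ j) \<partial>P)"

text \<open>For measurable \<open>N\<close> on a probability space the set below is bounded,
  and it contains \<open>0\<close>, so this supremum in \<open>nat\<close> is a maximum.\<close>
definition ess_inf_nat :: "'w measure \<Rightarrow> ('w \<Rightarrow> nat) \<Rightarrow> nat" where
  "ess_inf_nat P N = Sup {n. AE \<omega> in P. n \<le> N \<omega>}"

text \<open>The law of \<open>\<Sum>k=1..N. A k *v Z(k)\<close>, where \<open>Z(1), Z(2), \<dots>\<close> are i.i.d. with law \<open>\<mu>\<close>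
  and independent of \<open>(N, A 1, A 2, \<dots>)\<close>. The copies are realised as the coordinates of the
  second factor of a product space; the law does not depend on the realisation.\<close>
definition smoothing_law ::
  "'w measure \<Rightarrow> ('w \<Rightarrow> nat) \<Rightarrow> (nat \<Rightarrow> 'w \<Rightarrow> real^'n^'n) \<Rightarrow> (real^'n) measure \<Rightarrow> (real^'n) measure" where
  "smoothing_law P N A \<mu> =
     distr (P \<Otimes>\<^sub>M (\<Pi>\<^sub>M k\<in>{1..}. \<mu>)) borel (\<lambda>(\<omega>, z). \<Sum>k=1..N \<omega>. A k \<omega> *v z k)"

text \<open>The random vector \<open>Z\<close> may live on a probability space \<open>Q\<close> other than that of \<open>(N, A)\<close>.\<close>
definition is_solution ::
  "'w measure \<Rightarrow> ('w \<Rightarrow> nat) \<Rightarrow> (nat \<Rightarrow> 'w \<Rightarrow> real^'n^'n) \<Rightarrow> 'z measure \<Rightarrow> ('z \<Rightarrow> real^'n) \<Rightarrow> bool" where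
  "is_solution P N A Q Z \<longleftrightarrow>
     prob_space Q \<and> Z \<in> borel_measurable Q \<and> (AE \<omega> in Q. Z \<omega> \<in> nonneg_orthant) \<and>
     distr Q borel Z = smoothing_law P N A (distr Q borel Z)"

definition nontrivial_solution ::
  "'w measure \<Rightarrow> ('w \<Rightarrow> nat) \<Rightarrow> (nat \<Rightarrow> 'w \<Rightarrow> real^'n^'n) \<Rightarrow> 'z measure \<Rightarrow> ('z \<Rightarrow> real^'n) \<Rightarrow> bool" where
  "nontrivial_solution P N A Q Z \<longleftrightarrow> is_solution P N A Q Z \<and> \<not> (AE \<omega> in Q. Z \<omega> = 0)"

definition laplace :: "'z measure \<Rightarrow> ('z \<Rightarrow> real^'n) \<Rightarrow> real^'n \<Rightarrow> real" where
  "laplace Q Z t = (\<integral>\<omega>. exp (- (t \<bullet> Z \<omega>)) \<partial>Q)"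

text \<open>The exponent for the least number of summands \<open>m\<close>, dimension \<open>p\<close> and entry size \<open>b\<close>.\<close>
definition gamma_exponent :: "nat \<Rightarrow> nat \<Rightarrow> real \<Rightarrow> real" where
  "gamma_exponent m p b = - ln (real m) / ln (b * real p)"

end

theory Submission
  imports Defs "HOL-Real_Asymp.Real_Asymp"
begin

text \<open>
  Conditioning on \<open>(N, A)\<close> turns the distributional equation into
  \<open>\<phi>(t) = E (\<Prod>k=1..N. \<phi>(A k\<^sup>T t))\<close>. As \<open>\<phi>\<close> decreases in each coordinate, the entry bounds
  on the first \<open>m\<close> matrices reduce everything to \<open>\<psi>(s) = \<phi>(s, \<dots>, s)\<close>:
  \<open>\<psi>(s) \<le> \<psi>(aps)^m\<close> always, and \<open>\<psi>(s) \<ge> q \<psi>(bps)^m\<close> when the event of (b), with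
  \<open>b = a + \<epsilon>\<close>, has probability \<open>q\<close>. Iterating these down to a bounded range of \<open>s\<close> gives
  the growth rates of \<open>- ln \<phi>\<close>, and a Chernoff bound with optimised parameter (respectively its
  reverse) transfers them to the small-ball probabilities.

  The mean matrix has entries at least \<open>ma\<close>, so its Perron eigenvalue is at least \<open>map\<close>;
  hence \<open>map \<le> 1\<close>, with equality only if every entry equals \<open>ma\<close>.
\<close>

section \<open>Perron eigenvector of a positive matrix and the entry bound it yields\<close>

text \<open>The normalised map \<open>x \<mapsto> M x / \<parallel>M x\<parallel>\<^sub>1\<close> has a fixed point on the simplex by Brouwer.\<close>

lemma positive_matrix_eigenvector:
  fixes M :: "real^'n^'n"
  assumes pos: "\<And>i j. 0 < M $ i $ j"
  obtains r x where "0 < r" "\<And>i. 0 < x $ i" "M *v x = r *s x"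
proof -
  define S where "S = {x::real^'n. (\<forall>i. 0 \<le> x $ i) \<and> (\<Sum>i\<in>UNIV. x $ i) = 1}"
  define \<sigma> where "\<sigma> x = (\<Sum>i\<in>UNIV. (M *v x) $ i)" for x
  have mv_pos: "0 < (M *v x) $ i" if x: "x \<in> S" for x i
  proof -
    have "0 < (\<Sum>j\<in>UNIV. x $ j)" using x by (simp add: S_def)
    moreover have "\<forall>j. 0 \<le> x $ j" using x by (simp add: S_def)
    ultimately obtain j where j: "0 < x $ j"
      by (metis (mono_tags) linorder_not_less sum_nonpos)
    have "0 < M $ i $ j * x $ j" using j pos by simp
    also have "\<dots> \<le> (\<Sum>j\<in>UNIV. M $ i $ j * x $ j)"
      using x pos by (intro member_le_sum) (auto simp: S_def less_imp_le)
    finally show ?thesis by (simp add: matrix_vector_mult_def)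
  qed
  have \<sigma>_pos: "0 < \<sigma> x" if "x \<in> S" for x
    unfolding \<sigma>_def using mv_pos[OF that] by (intro sum_pos) auto
  have "closed S"
    unfolding S_def
    by (intro closed_Collect_conj closed_Collect_all closed_Collect_le closed_Collect_eq
        continuous_intros)
  moreover have "bounded S"
  proof (rule boundedI)
    fix x assume "x \<in> S"
    then show "norm x \<le> 1"
      using norm_le_l1_cart[of x] by (simp add: S_def)
  qed
  ultimately have "compact S" by (simp add: compact_eq_bounded_closed)
  moreover have "convex S"
    by (auto simp: S_def convex_def sum.distrib simp flip: sum_distrib_left)
  moreover have "S \<noteq> {}"
  proof -
    have "(\<chi> i. 1 / real CARD('n)) \<in> S" by (simp add: S_def)
    then show ?thesis by blast
  qed
  moreover have "continuous_on S (\<lambda>x. (1 / \<sigma> x) *\<^sub>R (M *v x))"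
    using \<sigma>_pos unfolding \<sigma>_def
    by (intro continuous_intros) (auto simp: less_le)
  moreover have "(\<lambda>x. (1 / \<sigma> x) *\<^sub>R (M *v x)) \<in> S \<rightarrow> S"
  proof
    fix x assume x: "x \<in> S"
    have "0 \<le> ((1 / \<sigma> x) *\<^sub>R (M *v x)) $ i" for i
      using \<sigma>_pos[OF x] mv_pos[OF x, of i] by simp
    moreover have "(\<Sum>i\<in>UNIV. ((1 / \<sigma> x) *\<^sub>R (M *v x)) $ i) = 1"
      using \<sigma>_pos[OF x] by (simp add: \<sigma>_def flip: sum_divide_distrib)
    ultimately show "(1 / \<sigma> x) *\<^sub>R (M *v x) \<in> S" by (simp add: S_def)
  qed
  ultimately obtain x where x: "x \<in> S" and fixpoint: "(1 / \<sigma> x) *\<^sub>R (M *v x) = x"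
    using brouwer by blast
  have "M *v x = \<sigma> x *s x"
    using \<sigma>_pos[OF x] arg_cong[OF fixpoint, of "\<lambda>v. \<sigma> x *\<^sub>R v"] by (simp add: scalar_mult_eq_scaleR)
  \<comment> \<open>Membership in \<open>S\<close> only gives nonnegative coordinates; strict
    positivity comes from \<open>M *v x\<close>, which is positive in every coordinate for any point
    of \<open>S\<close>.\<close>
  moreover from this have "0 < x $ i" for i
    using mv_pos[OF x, of i] \<sigma>_pos[OF x] by (simp add: zero_less_mult_iff)
  ultimately show ?thesis using that \<sigma>_pos[OF x] by blast
qed

text \<open>The spectrum is defined over the complex numbers, so a real eigenvector has to be
  embedded coordinatewise before maximality of the modulus can be applied to its eigenvalue.\<close>

lemma real_eigenvalue_in_eigenvalues:
  fixes x :: "real^'n"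
  assumes "M *v x = r *s x" "x \<noteq> 0"
  shows "complex_of_real r \<in> eigenvalues M"
proof -
  define v where "v = (\<chi> i. complex_of_real (x $ i))"
  have "v \<noteq> 0" using assms(2) by (auto simp: v_def vec_eq_iff)
  moreover have "map_matrix complex_of_real M *v v = complex_of_real r *s v"
    using assms(1) unfolding vec_eq_iff
    by (simp add: v_def matrix_vector_mult_def map_matrix_def flip: of_real_mult of_real_sum)
  ultimately show ?thesis unfolding eigenvalues_def by blast
qed

text \<open>Take a positive eigenvector \<open>x\<close>, with eigenvalue \<open>r \<le> 1\<close>,
  and let \<open>s\<close> be its coordinate sum. Each row gives
  \<open>c * s \<le> r * x $ i\<close>, and summing the rows gives
  \<open>c * CARD('n) \<le> r\<close>. In the equality case no row has slack, and positivity of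
  \<open>x\<close> passes this on to the single entries.\<close>

lemma max_eigenvalue_one_entry_bound:
  fixes M :: "real^'n^'n"
  assumes mev: "max_modulus_eigenvalue M 1" and c: "0 < c" and Mc: "\<And>i j. c \<le> M $ i $ j"
  shows "c * real CARD('n) \<le> 1"
    and "c * real CARD('n) = 1 \<Longrightarrow> M $ i $ j = c"
proof -
  have "\<And>i j. 0 < M $ i $ j" using c Mc less_le_trans by blast
  then obtain r x where r: "0 < r" and x: "\<And>i. 0 < x $ i" and ev: "M *v x = r *s x"
    using positive_matrix_eigenvector[of M] by blast
  have "x \<noteq> 0" using x by (metis less_irrefl zero_index)
  then have "cmod (complex_of_real r) \<le> cmod 1"
    using mev real_eigenvalue_in_eigenvalues[OF ev] unfolding max_modulus_eigenvalue_def by blast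
  then have r1: "r \<le> 1" using r by simp
  define s where "s = (\<Sum>j\<in>UNIV. x $ j)"
  have s: "0 < s" unfolding s_def using x by (intro sum_pos) auto
  have row: "r * x $ i = (\<Sum>j\<in>UNIV. M $ i $ j * x $ j)" for i
    using arg_cong[OF ev, of "\<lambda>v. v $ i"] by (simp add: matrix_vector_mult_def)
  have row_ge: "c * s \<le> r * x $ i" for i
    unfolding row s_def sum_distrib_left using Mc x
    by (intro sum_mono mult_right_mono) (auto simp: less_imp_le)
  have "(\<Sum>i::'n\<in>UNIV. c * s) \<le> (\<Sum>i\<in>UNIV. r * x $ i)"
    using row_ge by (intro sum_mono)
  then have "(c * real CARD('n)) * s \<le> r * s"
    by (simp add: s_def mult_ac flip: sum_distrib_left)
  then have cr: "c * real CARD('n) \<le> r" using s by simp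
  then show "c * real CARD('n) \<le> 1" using r1 by simp
  assume eq: "c * real CARD('n) = 1"
  \<comment> \<open>Here \<open>r\<close> is squeezed between \<open>c * CARD('n) = 1\<close> and 1,
    so the nonnegative row slacks add up to zero and each of them vanishes.\<close>
  have "(\<Sum>i\<in>UNIV. r * x $ i - c * s) = r * s - c * real CARD('n) * s"
    by (simp add: sum_subtractf s_def mult_ac flip: sum_distrib_left)
  also have "\<dots> = 0" using cr r1 eq by simp
  finally have "r * x $ i - c * s = 0"
    by (subst (asm) sum_nonneg_eq_0_iff) (use row_ge in auto)
  then have "(\<Sum>j\<in>UNIV. (M $ i $ j - c) * x $ j) = 0"
    by (simp add: row s_def left_diff_distrib sum_subtractf sum_distrib_left)
  then have "(M $ i $ j - c) * x $ j = 0"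
    by (subst (asm) sum_nonneg_eq_0_iff) (use Mc x in \<open>auto intro!: mult_nonneg_nonneg simp: less_imp_le\<close>)
  then show "M $ i $ j = c" using x[of j] by simp
qed

section \<open>Power growth from iterated scaling inequalities\<close>

text \<open>The exponent is the one for which \<open>1 / c ^ j\<close> raised to it equals
  \<open>m ^ j\<close>. Taking \<open>n\<close> as the last index with
  \<open>c ^ n * s \<ge> 1\<close> places \<open>s\<close> between \<open>1 / c ^ n\<close> and
  \<open>1 / c ^ Suc n\<close>, and raising to the exponent turns these into powers of
  \<open>m\<close>.\<close>

lemma powr_scale_bracket:
  fixes c s :: real
  assumes c: "0 < c" "c < 1" and m: "2 \<le> m" and s: "1 \<le> s"
  obtains n :: nat where "c ^ Suc n * s < 1" "1 \<le> c ^ n * s"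
    "real m ^ n \<le> s powr (- ln m / ln c)" "s powr (- ln m / ln c) \<le> real m ^ Suc n"
proof -
  let ?g = "- ln (real m) / ln c"
  have g: "0 \<le> ?g" using c m by (simp add: divide_nonneg_neg)
  have "\<exists>k. c ^ k * s < 1"
  proof -
    obtain k where "c ^ k < 1 / s"
      using real_arch_pow_inv[of "1 / s" c] c s by auto
    then show ?thesis using s by (auto simp: field_simps)
  qed
  then obtain k where k: "c ^ k * s < 1" and least: "\<And>j. j < k \<Longrightarrow> \<not> c ^ j * s < 1"
    using exists_least_iff[of "\<lambda>k. c ^ k * s < 1"] by blast
  \<comment> \<open>The case \<open>k = 0\<close> is excluded by \<open>1 \<le> s\<close>, so the
    least index with value below 1 has a predecessor.\<close>
  from k s obtain n where n: "k = Suc n" by (cases k) auto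
  have pw: "real m ^ j = (1 / c ^ j) powr ?g" for j
  proof -
    have "(1 / c ^ j) powr ?g = exp (?g * ln (1 / c ^ j))" using c by (simp add: powr_def)
    also have "?g * ln (1 / c ^ j) = real j * ln m"
      using c by (simp add: ln_div ln_realpow field_simps)
    finally show ?thesis using m by (simp add: exp_of_nat_mult)
  qed
  have lo: "1 \<le> c ^ n * s" using least[of n] n by simp
  have "real m ^ n \<le> s powr ?g" unfolding pw
    using lo c g by (intro powr_mono2) (auto simp: field_simps)
  moreover have "s powr ?g \<le> real m ^ Suc n" unfolding pw
    using k n c g s by (intro powr_mono2) (auto simp: field_simps)
  ultimately show ?thesis using that k n lo by blast
qed

text \<open>Iterating \<open>Suc n\<close> times brings the argument below 1, where \<open>B\<close>
  bounds \<open>g\<close>; the one step beyond \<open>m ^ n\<close> accounts for the extra factor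
  \<open>m\<close>.\<close>

lemma scaling_upper_growth:
  fixes g :: "real \<Rightarrow> real" and m :: nat and B :: real
  assumes c: "0 < c" "c < 1" and m: "2 \<le> m"
    and step: "\<And>s. 0 < s \<Longrightarrow> g s \<le> m * g (c * s)"
    and bound: "\<And>s. 0 < s \<Longrightarrow> s \<le> 1 \<Longrightarrow> g s \<le> B" and B: "0 \<le> B" and s: "1 \<le> s"
  shows "g s \<le> m * B * s powr (- ln m / ln c)"
proof -
  have iter: "g s \<le> real m ^ n * g (c ^ n * s)" for n
  proof (induction n)
    case (Suc n)
    have "real m ^ n * g (c ^ n * s) \<le> real m ^ n * (m * g (c * (c ^ n * s)))"
      using step[of "c ^ n * s"] c s by (intro mult_left_mono) auto
    with Suc show ?case by (simp add: mult_ac)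
  qed simp
  obtain n where n: "c ^ Suc n * s < 1" "real m ^ n \<le> s powr (- ln m / ln c)"
    using powr_scale_bracket[OF c m s] by metis
  have "g s \<le> real m ^ Suc n * g (c ^ Suc n * s)" by (rule iter)
  also have "\<dots> \<le> real m ^ Suc n * B" using n c s by (intro mult_left_mono bound) auto
  also have "\<dots> = m * B * real m ^ n" by simp
  also have "\<dots> \<le> m * B * s powr (- ln m / ln c)"
    using n B by (intro mult_left_mono) auto
  finally show ?thesis .
qed

text \<open>The iteration now stops at \<open>n\<close>, while the argument is still at least 1 and
  \<open>b\<close> bounds \<open>g\<close> from below; stopping one step short of
  \<open>m ^ Suc n\<close> accounts for the division by \<open>m\<close>.\<close>

lemma scaling_lower_growth:
  fixes g :: "real \<Rightarrow> real" and m :: nat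
  assumes c: "0 < c" "c < 1" and m: "2 \<le> m"
    and step: "\<And>s. 0 < s \<Longrightarrow> m * g (c * s) \<le> g s"
    and bound: "\<And>s. 1 \<le> s \<Longrightarrow> b \<le> g s" and b: "0 \<le> b" and s: "1 \<le> s"
  shows "b / m * s powr (- ln m / ln c) \<le> g s"
proof -
  have iter: "real m ^ n * g (c ^ n * s) \<le> g s" for n
  proof (induction n)
    case (Suc n)
    have "real m ^ n * (m * g (c * (c ^ n * s))) \<le> real m ^ n * g (c ^ n * s)"
      using step[of "c ^ n * s"] c s by (intro mult_left_mono) auto
    with Suc show ?case by (simp add: mult_ac)
  qed simp
  obtain n where n: "1 \<le> c ^ n * s" "s powr (- ln m / ln c) \<le> real m ^ Suc n"
    using powr_scale_bracket[OF c m s] by metis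
  have "b / m * s powr (- ln m / ln c) \<le> b / m * real m ^ Suc n"
    using n b by (intro mult_left_mono) auto
  also have "\<dots> = real m ^ n * b" using m by simp
  also have "\<dots> \<le> real m ^ n * g (c ^ n * s)" using n by (intro mult_left_mono bound) auto
  also have "\<dots> \<le> g s" by (rule iter)
  finally show ?thesis .
qed

section \<open>Transfer between decay of a Laplace transform and small-ball probabilities\<close>

context prob_space
begin

text \<open>Chernoff bound: the probability is at most \<open>exp (s * x)\<close> times the
  transform at \<open>s\<close>, hence at most \<open>exp (s * x - C * s powr \<gamma>)\<close>, for
  a suitable \<open>s\<close> depending on \<open>x\<close>.\<close>

lemma small_ball_upper_of_laplace:
  fixes Y :: "'a \<Rightarrow> real"
  assumes Y[measurable]: "Y \<in> borel_measurable M" and Y0: "AE \<omega> in M. 0 \<le> Y \<omega>"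
    and C: "0 < C" and \<gamma>: "0 < \<gamma>" "\<gamma> < 1"
    and L: "\<And>s. R \<le> s \<Longrightarrow> expectation (\<lambda>\<omega>. exp (- (s * Y \<omega>))) \<le> exp (- C * s powr \<gamma>)"
  shows "\<exists>K>0. \<forall>\<^sub>F x in at_right 0.
    prob {\<omega>\<in>space M. Y \<omega> \<le> x} \<le> exp (- K * x powr (- \<gamma> / (1 - \<gamma>)))"
proof -
  \<comment> \<open>Chosen so that \<open>s x * x\<close> is half of
    \<open>C * s x powr \<gamma>\<close>. The exact minimiser has \<open>C * \<gamma>\<close> in
    place of \<open>C / 2\<close>, which affects only the constant \<open>K\<close>.\<close>
  define s where "s x = (C / 2 / x) powr (1 / (1 - \<gamma>))" for x
  define K where "K = C / 2 * (C / 2) powr (\<gamma> / (1 - \<gamma>))"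
  have "filterlim s at_top (at_right 0)"
    unfolding s_def using C \<gamma> by real_asymp
  then have "\<forall>\<^sub>F x in at_right 0. max R 0 \<le> s x" unfolding filterlim_at_top by blast
  moreover have "\<forall>\<^sub>F x::real in at_right 0. 0 < x" by (rule eventually_at_right_less)
  ultimately have "\<forall>\<^sub>F x in at_right 0.
    prob {\<omega>\<in>space M. Y \<omega> \<le> x} \<le> exp (- K * x powr (- \<gamma> / (1 - \<gamma>)))"
  proof eventually_elim
    case (elim x)
    then have s0: "0 \<le> s x" "R \<le> s x" by auto
    have int: "integrable M (\<lambda>\<omega>. exp (- (s x * Y \<omega>)))"
      using Y0 s0 by (intro integrable_const_bound[where B = 1]) auto
    have sg: "s x powr \<gamma> = (C / 2 / x) powr (\<gamma> / (1 - \<gamma>))"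
      by (simp add: s_def powr_powr)
    have sx: "s x powr \<gamma> = (C / 2) powr (\<gamma> / (1 - \<gamma>)) * x powr (- \<gamma> / (1 - \<gamma>))"
      unfolding sg using elim C powr_divide[of "C / 2" x] by (simp add: powr_minus_divide)
    \<comment> \<open>Splitting \<open>1 / (1 - \<gamma>)\<close> as
      \<open>1 + \<gamma> / (1 - \<gamma>)\<close> exhibits the balance between
      \<open>s x * x\<close> and \<open>s x powr \<gamma>\<close>.\<close>
    have "s x = (C / 2 / x) powr (1 + \<gamma> / (1 - \<gamma>))"
      unfolding s_def using \<gamma> by (intro arg_cong2[where f = "(powr)"]) (auto simp: field_simps)
    then have "s x = C / 2 / x * s x powr \<gamma>"
      using elim C by (subst sg) (simp add: powr_add)
    then have sx': "s x * x = C / 2 * s x powr \<gamma>"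
      using elim C by (simp add: field_simps)
    have "prob {\<omega>\<in>space M. Y \<omega> \<le> x} =
        expectation (\<lambda>\<omega>. indicator {\<omega>\<in>space M. Y \<omega> \<le> x} \<omega>)"
      by simp
    also have "\<dots> \<le> expectation (\<lambda>\<omega>. exp (s x * x) * exp (- (s x * Y \<omega>)))"
    proof (rule integral_mono)
      show "integrable M (\<lambda>\<omega>. exp (s x * x) * exp (- (s x * Y \<omega>)))" using int by simp
      fix \<omega> show "indicator {\<omega>\<in>space M. Y \<omega> \<le> x} \<omega> \<le> exp (s x * x) * exp (- (s x * Y \<omega>))"
        using s0 by (auto simp: indicator_def mult_left_mono simp flip: exp_add)
    qed (auto simp: emeasure_eq_measure)
    also have "\<dots> = exp (s x * x) * expectation (\<lambda>\<omega>. exp (- (s x * Y \<omega>)))" by simp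
    also have "\<dots> \<le> exp (s x * x) * exp (- C * s x powr \<gamma>)"
      by (intro mult_left_mono L s0) auto
    also have "\<dots> = exp (- (C / 2) * s x powr \<gamma>)" by (simp add: sx' flip: exp_add)
    also have "\<dots> = exp (- K * x powr (- \<gamma> / (1 - \<gamma>)))" by (simp add: sx K_def)
    finally show ?case .
  qed
  moreover have "0 < K" using C by (simp add: K_def)
  ultimately show ?thesis by blast
qed

text \<open>Splitting the expectation at \<open>Y = x\<close> bounds the transform by the
  probability plus \<open>exp (- (s * x))\<close>. The latter is negligible against the assumed
  lower bound once \<open>s * x\<close> is a large enough multiple of
  \<open>s powr \<gamma>\<close>.\<close>

lemma small_ball_lower_of_laplace:
  fixes Y :: "'a \<Rightarrow> real"
  assumes Y[measurable]: "Y \<in> borel_measurable M" and Y0: "AE \<omega> in M. 0 \<le> Y \<omega>"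
    and C: "0 < C" and \<gamma>: "0 < \<gamma>" "\<gamma> < 1"
    and L: "\<And>s. R \<le> s \<Longrightarrow> exp (- C * s powr \<gamma>) \<le> expectation (\<lambda>\<omega>. exp (- (s * Y \<omega>)))"
  shows "\<exists>K>0. \<forall>\<^sub>F x in at_right 0.
    exp (- K * x powr (- \<gamma> / (1 - \<gamma>))) \<le> prob {\<omega>\<in>space M. Y \<omega> \<le> x}"
proof -
  \<comment> \<open>chosen so that \<open>s x * x = 2 * C * s x powr \<gamma>\<close>: the Markov error is the square of the main term\<close>
  define s where "s x = (2 * C / x) powr (1 / (1 - \<gamma>))" for x
  define K where "K = 2 * C * (2 * C) powr (\<gamma> / (1 - \<gamma>))"
  have "filterlim s at_top (at_right 0)"
    unfolding s_def using C \<gamma> by real_asymp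
  then have "\<forall>\<^sub>F x in at_right 0. max R 0 \<le> s x" unfolding filterlim_at_top by blast
  moreover have "filterlim (\<lambda>x. C * s x powr \<gamma>) at_top (at_right 0)"
    unfolding s_def using C \<gamma> by real_asymp
  then have "\<forall>\<^sub>F x in at_right 0. 1 \<le> C * s x powr \<gamma>" by (simp add: filterlim_at_top)
  moreover have "\<forall>\<^sub>F x::real in at_right 0. 0 < x" by (rule eventually_at_right_less)
  ultimately have "\<forall>\<^sub>F x in at_right 0.
    exp (- K * x powr (- \<gamma> / (1 - \<gamma>))) \<le> prob {\<omega>\<in>space M. Y \<omega> \<le> x}"
  proof eventually_elim
    case (elim x)
    then have s0: "0 \<le> s x" "R \<le> s x" by auto
    have int: "integrable M (\<lambda>\<omega>. exp (- (s x * Y \<omega>)))"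
      using Y0 s0 by (intro integrable_const_bound[where B = 1]) auto
    define u where "u = C * s x powr \<gamma>"
    have u: "1 \<le> u" using elim by (simp add: u_def)
    have sg: "s x powr \<gamma> = (2 * C / x) powr (\<gamma> / (1 - \<gamma>))"
      by (simp add: s_def powr_powr)
    have sx: "s x powr \<gamma> = (2 * C) powr (\<gamma> / (1 - \<gamma>)) * x powr (- \<gamma> / (1 - \<gamma>))"
      unfolding sg using elim C powr_divide[of "2 * C" x] by (simp add: powr_minus_divide)
    have "s x = (2 * C / x) powr (1 + \<gamma> / (1 - \<gamma>))"
      unfolding s_def using \<gamma> by (intro arg_cong2[where f = "(powr)"]) (auto simp: field_simps)
    then have "s x = 2 * C / x * s x powr \<gamma>"
      using elim C by (subst sg) (simp add: powr_add)
    then have sx': "s x * x = 2 * u"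
      using elim C by (simp add: field_simps u_def)
    have "exp (- u) \<le> expectation (\<lambda>\<omega>. exp (- (s x * Y \<omega>)))"
      using L[OF s0(2)] by (simp add: u_def)
    also have "\<dots> \<le> expectation (\<lambda>\<omega>. indicator {\<omega>\<in>space M. Y \<omega> \<le> x} \<omega> + exp (- (s x * x)))"
    proof (rule integral_mono_AE[OF int])
      show "integrable M (\<lambda>\<omega>. indicator {\<omega>\<in>space M. Y \<omega> \<le> x} \<omega> + exp (- (s x * x)))"
        by (auto simp: emeasure_eq_measure)
      show "AE \<omega> in M. exp (- (s x * Y \<omega>))
          \<le> indicator {\<omega>\<in>space M. Y \<omega> \<le> x} \<omega> + exp (- (s x * x))"
        using Y0 AE_space
      proof eventually_elim
        case (elim \<omega>)
        have "exp (- (s x * Y \<omega>)) \<le> 1" using elim s0 by simp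
        moreover have "exp (- (s x * Y \<omega>)) \<le> exp (- (s x * x))" if "x < Y \<omega>"
          using that s0 by (simp add: mult_left_mono)
        ultimately show ?case using elim by (auto simp: indicator_def add_increasing2 not_le)
      qed
    qed
    also have "\<dots> = prob {\<omega>\<in>space M. Y \<omega> \<le> x} + exp (- (s x * x))"
      by (subst Bochner_Integration.integral_add)
        (auto simp: emeasure_eq_measure prob_space)
    finally have "exp (- u) - exp (- (2 * u)) \<le> prob {\<omega>\<in>space M. Y \<omega> \<le> x}"
      by (simp add: sx')
    \<comment> \<open>Subtracting the error therefore leaves at least
      \<open>exp (- (2 * u))\<close>, so the loss is only a doubled constant.\<close>
    moreover have "2 * exp (- (2 * u)) \<le> exp (- u)"
    proof -
      have "2 \<le> exp u" using exp_ge_add_one_self[of u] u by linarith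
      then have "2 * exp (- (2 * u)) \<le> exp u * exp (- (2 * u))" by (intro mult_right_mono) auto
      then show ?thesis by (simp flip: exp_add)
    qed
    moreover have "K * x powr (- \<gamma> / (1 - \<gamma>)) = 2 * u" by (simp add: K_def u_def sx)
    ultimately show ?case by simp
  qed
  moreover have "0 < K" using C by (simp add: K_def)
  ultimately show ?thesis by blast
qed

end

section \<open>The nonnegative orthant, the l1 norm and measurability of matrix operations\<close>

lemma nonneg_orthant_iff: "v \<in> nonneg_orthant \<longleftrightarrow> (\<forall>i. 0 \<le> v $ i)"
  by (simp add: nonneg_orthant_def)

lemma inner_nonneg_orthant:
  assumes "u \<in> nonneg_orthant" "v \<in> nonneg_orthant"
  shows "0 \<le> u \<bullet> v"
  using assms by (auto simp: inner_vec_def nonneg_orthant_iff intro!: sum_nonneg)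

lemma l1_norm_nonneg [simp]: "0 \<le> l1_norm t"
  by (simp add: l1_norm_def sum_nonneg)

lemma l1_norm_eq_sum: "t \<in> nonneg_orthant \<Longrightarrow> l1_norm t = (\<Sum>j\<in>UNIV. t $ j)"
  by (simp add: l1_norm_def nonneg_orthant_iff)

lemma l1_norm_scaleR: "0 \<le> s \<Longrightarrow> l1_norm (s *\<^sub>R t) = s * l1_norm t"
  by (simp add: l1_norm_def abs_mult sum_distrib_left)

lemma l1_norm_pos:
  assumes "t \<noteq> 0" shows "0 < l1_norm t"
proof -
  obtain i where "t $ i \<noteq> 0" using assms by (auto simp: vec_eq_iff)
  then show ?thesis unfolding l1_norm_def by (intro sum_pos2[of _ i]) auto
qed

lemma l1_norm_vec: "0 \<le> s \<Longrightarrow> l1_norm (vec s :: real^'n) = real CARD('n) * s"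
  by (simp add: l1_norm_def)

lemma vec_in_orthant: "0 \<le> s \<Longrightarrow> vec s \<in> nonneg_orthant"
  by (simp add: nonneg_orthant_iff)

lemma vector_matrix_mult_in_orthant:
  fixes B :: "real^'n^'m"
  assumes "t \<in> nonneg_orthant" "\<forall>i j. 0 \<le> B $ i $ j"
  shows "t v* B \<in> nonneg_orthant"
  using assms by (auto simp: nonneg_orthant_iff vector_matrix_mult_def intro!: sum_nonneg)

lemma borel_measurable_vec_lambda:
  fixes f :: "'n::finite \<Rightarrow> 'a \<Rightarrow> real"
  assumes "\<And>i. f i \<in> borel_measurable M"
  shows "(\<lambda>x. \<chi> i. f i x) \<in> borel_measurable M"
proof (rule iffD2[OF borel_measurable_euclidean_space], safe)
  fix b :: "real^'n" assume "b \<in> Basis"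
  then obtain i where "b = axis i 1" by (auto simp: Basis_vec_def)
  then show "(\<lambda>x. (\<chi> i. f i x) \<bullet> b) \<in> borel_measurable M"
    using assms by (simp add: inner_axis)
qed

lemma borel_measurable_vec_nth_comp [measurable (raw)]:
  fixes f :: "'a \<Rightarrow> 'b::second_countable_topology ^ 'n"
  assumes "f \<in> borel_measurable M"
  shows "(\<lambda>x. f x $ i) \<in> borel_measurable M"
  using measurable_compose[OF assms, of "\<lambda>v. v $ i" borel]
  by (simp add: borel_measurable_continuous_onI continuous_on_component)

lemma borel_measurable_matrix_vector_mult [measurable (raw)]:
  fixes f :: "'a \<Rightarrow> real^'n^'m"
  assumes [measurable]: "f \<in> borel_measurable M" "g \<in> borel_measurable M"
  shows "(\<lambda>x. f x *v g x) \<in> borel_measurable M"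
  unfolding matrix_vector_mult_def by (intro borel_measurable_vec_lambda) measurable

section \<open>Laplace transform of a random vector in the orthant\<close>

locale nonneg_random_vector = prob_space Q for Q :: "'z measure" +
  fixes Z :: "'z \<Rightarrow> real^'n"
  assumes Z_measurable [measurable]: "Z \<in> borel_measurable Q"
    and Z_nonneg: "AE \<omega> in Q. Z \<omega> \<in> nonneg_orthant"
begin

lemma inner_AE_nonneg: "t \<in> nonneg_orthant \<Longrightarrow> AE \<omega> in Q. 0 \<le> t \<bullet> Z \<omega>"
  using Z_nonneg by eventually_elim (rule inner_nonneg_orthant)

lemma integrable_exp:
  assumes "t \<in> nonneg_orthant"
  shows "integrable Q (\<lambda>\<omega>. exp (- (t \<bullet> Z \<omega>)))"
  using inner_AE_nonneg[OF assms] by (intro integrable_const_bound[where B = 1]) auto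

lemma laplace_le_1:
  assumes "t \<in> nonneg_orthant"
  shows "laplace Q Z t \<le> 1"
  unfolding laplace_def
  using inner_AE_nonneg[OF assms] by (intro integral_le_const integrable_exp assms) auto

lemma laplace_pos:
  assumes "t \<in> nonneg_orthant"
  shows "0 < laplace Q Z t"
proof -
  have "0 \<le> laplace Q Z t" unfolding laplace_def by simp
  moreover have "laplace Q Z t \<noteq> 0"
  proof
    assume "laplace Q Z t = 0"
    then have "AE \<omega> in Q. exp (- (t \<bullet> Z \<omega>)) = 0"
      unfolding laplace_def by (subst (asm) integral_nonneg_eq_0_iff_AE) (auto intro: integrable_exp assms)
    then show False by simp
  qed
  ultimately show ?thesis by simp
qed

lemma laplace_antimono:
  assumes s: "s \<in> nonneg_orthant" and st: "\<And>i. s $ i \<le> t $ i"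
  shows "laplace Q Z t \<le> laplace Q Z s"
proof -
  have t: "t \<in> nonneg_orthant" using s st unfolding nonneg_orthant_iff by (meson order_trans)
  have "AE \<omega> in Q. exp (- (t \<bullet> Z \<omega>)) \<le> exp (- (s \<bullet> Z \<omega>))"
    using Z_nonneg
  proof eventually_elim
    case (elim \<omega>)
    then have "(\<Sum>i\<in>UNIV. s $ i * Z \<omega> $ i) \<le> (\<Sum>i\<in>UNIV. t $ i * Z \<omega> $ i)"
      by (intro sum_mono mult_right_mono st) (simp add: nonneg_orthant_iff)
    then show ?case by (simp add: inner_vec_def)
  qed
  then show ?thesis unfolding laplace_def by (intro integral_mono_AE integrable_exp s t)
qed

text \<open>All coordinates of \<open>vec s\<close> are positive, so
  \<open>vec s \<bullet> Z \<omega> = 0\<close> forces \<open>Z \<omega> = 0\<close>. Through this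
  strict inequality non-triviality provides the positive starting value for the growth of
  \<open>- ln \<phi>\<close>.\<close>

lemma laplace_less_1:
  assumes nz: "\<not> (AE \<omega> in Q. Z \<omega> = 0)" and s: "0 < s"
  shows "laplace Q Z (vec s) < 1"
proof -
  have t: "vec s \<in> nonneg_orthant" using s by (simp add: nonneg_orthant_iff)
  have "laplace Q Z (vec s) \<noteq> 1"
  proof
    assume "laplace Q Z (vec s) = 1"
    then have "(\<integral>\<omega>. 1 - exp (- (vec s \<bullet> Z \<omega>)) \<partial>Q) = 0"
      using integrable_exp[OF t] by (simp add: laplace_def prob_space)
    then have "AE \<omega> in Q. 1 - exp (- (vec s \<bullet> Z \<omega>)) = 0"
      using inner_AE_nonneg[OF t] integrable_exp[OF t]
      by (subst (asm) integral_nonneg_eq_0_iff_AE) auto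
    with Z_nonneg have "AE \<omega> in Q. Z \<omega> = 0"
    proof eventually_elim
      case (elim \<omega>)
      then have "(\<Sum>i\<in>UNIV. s * Z \<omega> $ i) = 0" by (simp add: inner_vec_def)
      then have "\<forall>i. s * Z \<omega> $ i = 0"
        by (subst (asm) sum_nonneg_eq_0_iff)
          (use elim s in \<open>auto simp: nonneg_orthant_iff\<close>)
      then show ?case using s by (simp add: vec_eq_iff)
    qed
    with nz show False by simp
  qed
  with laplace_le_1[OF t] show ?thesis by simp
qed

lemma laplace_distr: "(\<integral>z. exp (- (t \<bullet> z)) \<partial>distr Q borel Z) = laplace Q Z t"
  unfolding laplace_def by (subst integral_distr) auto

end

section \<open>The functional equation of the Laplace transform\<close>

text \<open>The integrand depends only on the coordinates in \<open>J\<close>, and restriction to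
  \<open>J\<close> maps the possibly infinite product measure to a finite one, where the integral
  factorises.\<close>

lemma (in product_prob_space) integral_PiM_finite_prod:
  fixes f :: "'i \<Rightarrow> 'a \<Rightarrow> real"
  assumes J: "finite J" "J \<subseteq> I" and f: "\<And>i. i \<in> J \<Longrightarrow> integrable (M i) (f i)"
  shows "(\<integral>x. (\<Prod>i\<in>J. f i (x i)) \<partial>PiM I M) = (\<Prod>i\<in>J. integral\<^sup>L (M i) (f i))"
proof -
  have [measurable]: "i \<in> J \<Longrightarrow> f i \<in> borel_measurable (M i)" for i using f by auto
  have "(\<Prod>i\<in>J. integral\<^sup>L (M i) (f i)) = (\<integral>x. (\<Prod>i\<in>J. f i (x i)) \<partial>PiM J M)"
    using J f by (subst product_integral_prod) auto
  also have "\<dots> = (\<integral>x. (\<Prod>i\<in>J. f i (restrict x J i)) \<partial>PiM I M)"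
    using J by (subst distr_PiM_restrict_finite[OF J, symmetric], intro integral_distr measurable_restrict_subset) auto
  finally show ?thesis by simp
qed

lemma prod_initial_const:
  assumes "m \<le> n"
  shows "(\<Prod>k=1..n. if k \<le> m then c else 1) = (c::real) ^ m"
proof -
  have "{1..n} \<inter> {k. k \<le> m} = {1..m}" using assms by auto
  then show ?thesis by (simp add: prod.If_cases)
qed

locale smoothing_solution = nonneg_random_vector Q Z + P: prob_space P
  for Q :: "'z measure" and Z :: "'z \<Rightarrow> real^'n" and P :: "'w measure" +
  fixes N :: "'w \<Rightarrow> nat" and A :: "nat \<Rightarrow> 'w \<Rightarrow> real^'n^'n"
  assumes N_measurable [measurable]: "N \<in> measurable P (count_space UNIV)"
    and A_measurable: "\<And>k. k \<ge> 1 \<Longrightarrow> A k \<in> borel_measurable P"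
    and A_nonneg_each: "\<And>k. k \<ge> 1 \<Longrightarrow> AE \<omega> in P. \<forall>i j. 0 \<le> A k \<omega> $ i $ j"
    and solution: "distr Q borel Z = smoothing_law P N A (distr Q borel Z)"
begin

lemma A_nonneg: "AE \<omega> in P. \<forall>k\<ge>1. \<forall>i j. 0 \<le> A k \<omega> $ i $ j"
  using A_nonneg_each by (simp add: AE_all_countable)

text \<open>Fubini on the product space of \<open>smoothing_law\<close>: for fixed
  \<open>\<omega>\<close> the copies are independent and
  \<open>t \<bullet> (A *v z) = (t v* A) \<bullet> z\<close>, so the inner integral is a product of
  transforms. Integrability is stated along with the identity because the comparisons below
  integrate inequalities.\<close>

lemma laplace_smoothing:
  assumes t: "t \<in> nonneg_orthant"
  shows "integrable P (\<lambda>\<omega>. \<Prod>k=1..N \<omega>. laplace Q Z (t v* A k \<omega>))" (is "integrable P ?F")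
    and "laplace Q Z t = (\<integral>\<omega>. (\<Prod>k=1..N \<omega>. laplace Q Z (t v* A k \<omega>)) \<partial>P)"
proof -
  define \<mu> where "\<mu> = distr Q borel Z"
  interpret \<mu>: prob_space \<mu> unfolding \<mu>_def by (rule prob_space_distr) simp
  interpret X: product_prob_space "\<lambda>_::nat. \<mu>" "{1..}" by unfold_locales
  let ?X = "\<Pi>\<^sub>M k\<in>{1::nat..}. \<mu>"
  interpret PX: pair_prob_space P ?X by unfold_locales
  define S where "S = (\<lambda>(\<omega>, z). \<Sum>k=1..N \<omega>. A k \<omega> *v (z k :: real^'n))"
  have sets_\<mu>[measurable_cong]: "sets \<mu> = sets borel" by (simp add: \<mu>_def)
  have term_meas: "(\<lambda>p. A k (fst p) *v snd p k) \<in> borel_measurable (P \<Otimes>\<^sub>M ?X)" if "k \<ge> 1" for k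
  proof -
    have [measurable]: "A k \<in> borel_measurable P" by (rule A_measurable[OF that])
    have "(\<lambda>z. z k) \<in> measurable ?X \<mu>" using that by (intro measurable_component_singleton) auto
    then have [measurable]: "(\<lambda>z. z k) \<in> borel_measurable ?X"
      by (simp add: measurable_cong_sets[OF refl sets_\<mu>])
    show ?thesis by measurable
  qed
  have S[measurable]: "S \<in> borel_measurable (P \<Otimes>\<^sub>M ?X)"
  proof -
    \<comment> \<open>The number of summands is random: measurability is shown for each fixed
      \<open>n\<close> and then glued over the countably many values of \<open>N\<close>.\<close>
    have "(\<lambda>p. \<Sum>k=1..n. A k (fst p) *v snd p k) \<in> borel_measurable (P \<Otimes>\<^sub>M ?X)" for n
      using term_meas by (intro borel_measurable_sum) auto
    then have "(\<lambda>p. \<Sum>k=1..N (fst p). A k (fst p) *v snd p k) \<in> borel_measurable (P \<Otimes>\<^sub>M ?X)"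
      by (rule measurable_compose_countable) measurable
    then show ?thesis unfolding S_def case_prod_unfold .
  qed
  have \<mu>_int: "integrable \<mu> (\<lambda>z. exp (- (u \<bullet> z)))" if "u \<in> nonneg_orthant" for u
    unfolding \<mu>_def using integrable_exp[OF that] by (subst integrable_distr_eq) auto
  have "laplace Q Z t = (\<integral>z. exp (- (t \<bullet> z)) \<partial>\<mu>)" by (simp add: laplace_distr \<mu>_def)
  also have "\<mu> = distr (P \<Otimes>\<^sub>M ?X) borel S"
    using solution by (simp add: smoothing_law_def \<mu>_def S_def)
  also have "(\<integral>z. exp (- (t \<bullet> z)) \<partial>distr (P \<Otimes>\<^sub>M ?X) borel S)
      = (\<integral>p. exp (- (t \<bullet> S p)) \<partial>(P \<Otimes>\<^sub>M ?X))"
    by (intro integral_distr S) simp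
  finally have L: "laplace Q Z t = (\<integral>p. exp (- (t \<bullet> S p)) \<partial>(P \<Otimes>\<^sub>M ?X))" .
  \<comment> \<open>\<open>S\<close> has law \<open>\<mu>\<close>, so integrability carries over
    from \<open>\<mu>_int\<close> without first examining the sign of \<open>S\<close>.\<close>
  have int: "integrable (P \<Otimes>\<^sub>M ?X) (\<lambda>p. exp (- (t \<bullet> S p)))"
  proof -
    have "integrable \<mu> (\<lambda>z. exp (- (t \<bullet> z)))" by (rule \<mu>_int[OF t])
    also have "\<mu> = distr (P \<Otimes>\<^sub>M ?X) borel S"
      using solution by (simp add: smoothing_law_def \<mu>_def S_def)
    finally show ?thesis by (subst (asm) integrable_distr_eq[OF S]) simp_all
  qed
  define G where "G \<omega> = (\<integral>z. exp (- (t \<bullet> S (\<omega>, z))) \<partial>?X)" for \<omega>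
  have G: "AE \<omega> in P. ?F \<omega> = G \<omega>"
    using A_nonneg
  proof eventually_elim
    case (elim \<omega>)
    have "G \<omega> = (\<integral>z. (\<Prod>k=1..N \<omega>. exp (- ((t v* A k \<omega>) \<bullet> z k))) \<partial>?X)"
      unfolding G_def S_def
      by (simp add: inner_sum_right dot_lmul_matrix exp_sum flip: sum_negf)
    also have "\<dots> = (\<Prod>k=1..N \<omega>. (\<integral>z. exp (- ((t v* A k \<omega>) \<bullet> z)) \<partial>\<mu>))"
      by (intro X.integral_PiM_finite_prod \<mu>_int vector_matrix_mult_in_orthant t) (use elim in auto)
    finally show ?case by (simp add: laplace_distr \<mu>_def)
  qed
  have intG: "integrable P G"
    unfolding G_def using int by (rule PX.integrable_fst')
  have "laplace Q Z t = (\<integral>\<omega>. G \<omega> \<partial>P)"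
    unfolding L G_def using int by (rule PX.integral_fst'[symmetric])
  \<comment> \<open>\<open>?F\<close> agrees with \<open>G\<close> only almost everywhere, so its
    measurability is established directly.\<close>
  have F_meas: "?F \<in> borel_measurable P"
  proof -
    have lm: "laplace Q Z \<in> borel_measurable borel"
      unfolding laplace_def by measurable
    have "(\<lambda>\<omega>. laplace Q Z (t v* A k \<omega>)) \<in> borel_measurable P" if "k \<ge> 1" for k
    proof (rule measurable_compose[OF _ lm])
      have [measurable]: "A k \<in> borel_measurable P" by (rule A_measurable[OF that])
      show "(\<lambda>\<omega>. t v* A k \<omega>) \<in> borel_measurable P"
        unfolding vector_matrix_mult_def by (intro borel_measurable_vec_lambda) measurable
    qed
    then have "(\<lambda>\<omega>. \<Prod>k=1..n. laplace Q Z (t v* A k \<omega>)) \<in> borel_measurable P" for n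
      by (intro borel_measurable_prod) auto
    then show ?thesis by (rule measurable_compose_countable) measurable
  qed
  show "integrable P ?F"
    using intG G F_meas by (subst integrable_cong_AE[where g = G]) auto
  show "laplace Q Z t = (\<integral>\<omega>. ?F \<omega> \<partial>P)"
    unfolding \<open>laplace Q Z t = (\<integral>\<omega>. G \<omega> \<partial>P)\<close>
    using intG G F_meas by (intro integral_cong_AE) auto
qed

section \<open>Comparison with the diagonal and growth of the exponent\<close>

text \<open>For \<open>k \<le> m\<close> every coordinate of \<open>t v* A k \<omega>\<close> is at
  least \<open>a * l1_norm t\<close>, which bounds the first \<open>m\<close> factors of the
  functional equation; the others are at most 1.\<close>

lemma laplace_le_power:
  assumes m: "AE \<omega> in P. m \<le> N \<omega>" and a: "0 < a"
    and A_ge: "AE \<omega> in P. \<forall>k\<in>{1..m}. \<forall>i j. a \<le> A k \<omega> $ i $ j"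
    and t: "t \<in> nonneg_orthant"
  shows "laplace Q Z t \<le> laplace Q Z (vec (a * l1_norm t)) ^ m"
proof -
  let ?L = "laplace Q Z (vec (a * l1_norm t))"
  have o: "vec (a * l1_norm t) \<in> nonneg_orthant" using a by (simp add: nonneg_orthant_iff)
  have "AE \<omega> in P. (\<Prod>k=1..N \<omega>. laplace Q Z (t v* A k \<omega>)) \<le> ?L ^ m"
    using m A_ge A_nonneg
  proof eventually_elim
    case (elim \<omega>)
    have "(\<Prod>k=1..N \<omega>. laplace Q Z (t v* A k \<omega>)) \<le> (\<Prod>k=1..N \<omega>. if k \<le> m then ?L else 1)"
    proof (rule prod_mono)
      fix k assume k: "k \<in> {1..N \<omega>}"
      then have orth: "t v* A k \<omega> \<in> nonneg_orthant"
        using elim t by (intro vector_matrix_mult_in_orthant) auto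
      have "laplace Q Z (t v* A k \<omega>) \<le> ?L" if "k \<le> m"
      proof (rule laplace_antimono[OF o])
        fix j
        have "(\<Sum>i\<in>UNIV. a * t $ i) \<le> (\<Sum>i\<in>UNIV. A k \<omega> $ i $ j * t $ i)"
          using elim k that t by (intro sum_mono mult_right_mono) (auto simp: nonneg_orthant_iff)
        then show "vec (a * l1_norm t) $ j \<le> (t v* A k \<omega>) $ j"
          by (simp add: vector_matrix_mult_def l1_norm_eq_sum[OF t] sum_distrib_left mult_ac)
      qed
      then show "0 \<le> laplace Q Z (t v* A k \<omega>) \<and>
          laplace Q Z (t v* A k \<omega>) \<le> (if k \<le> m then ?L else 1)"
        using laplace_pos[OF orth] laplace_le_1[OF orth] by simp
    qed
    also have "\<dots> = ?L ^ m" using elim by (intro prod_initial_const) simp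
    finally show ?case .
  qed
  then show ?thesis
    unfolding laplace_smoothing(2)[OF t]
    by (intro P.integral_le_const laplace_smoothing(1)[OF t])
qed

text \<open>Only the event \<open>E\<close> is kept. There exactly \<open>m\<close> factors occur,
  and each \<open>t v* A k \<omega>\<close> is at most \<open>b * l1_norm t\<close> in every
  coordinate; elsewhere the integrand is nonnegative.\<close>

lemma laplace_ge_power:
  fixes b :: real and m :: nat
  defines "q \<equiv> measure P {\<omega>\<in>space P. N \<omega> = m \<and> (\<forall>k\<in>{1..m}. \<forall>i j. A k \<omega> $ i $ j \<le> b)}"
  assumes q: "0 < q" and b: "0 \<le> b" and t: "t \<in> nonneg_orthant"
  shows "q * laplace Q Z (vec (b * l1_norm t)) ^ m \<le> laplace Q Z t"
proof -
  let ?L = "laplace Q Z (vec (b * l1_norm t))"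
  define E where "E = {\<omega>\<in>space P. N \<omega> = m \<and> (\<forall>k\<in>{1..m}. \<forall>i j. A k \<omega> $ i $ j \<le> b)}"
  have o: "vec (b * l1_norm t) \<in> nonneg_orthant" using b by (simp add: nonneg_orthant_iff)
  have q_E: "q = measure P E" by (simp only: q_def E_def)
  \<comment> \<open>A set outside the sigma-algebra has \<open>measure\<close> 0 by convention, so
    positivity of \<open>q\<close> already implies measurability.\<close>
  have E: "E \<in> sets P"
  proof (rule ccontr)
    assume "E \<notin> sets P"
    then have "q = 0" unfolding q_E by (rule measure_notin_sets)
    with q show False by simp
  qed
  have int: "integrable P (\<lambda>\<omega>. ?L ^ m * indicator E \<omega>)"
    using E by (simp add: P.emeasure_eq_measure)
  have "AE \<omega> in P. ?L ^ m * indicator E \<omega> \<le> (\<Prod>k=1..N \<omega>. laplace Q Z (t v* A k \<omega>))"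
    using A_nonneg
  proof eventually_elim
    case (elim \<omega>)
    have orth: "t v* A k \<omega> \<in> nonneg_orthant" if "k \<in> {1..N \<omega>}" for k
      using that elim t by (intro vector_matrix_mult_in_orthant) auto
    show ?case
    proof (cases "\<omega> \<in> E")
      case True
      have "?L ^ m = (\<Prod>k=1..N \<omega>. ?L)" using True by (simp add: E_def)
      also have "\<dots> \<le> (\<Prod>k=1..N \<omega>. laplace Q Z (t v* A k \<omega>))"
      proof (intro prod_mono conjI laplace_antimono orth)
        fix k j assume k: "k \<in> {1..N \<omega>}"
        have "(\<Sum>i\<in>UNIV. A k \<omega> $ i $ j * t $ i) \<le> (\<Sum>i\<in>UNIV. b * t $ i)"
          using True k t unfolding E_def by (intro sum_mono mult_right_mono) (auto simp: nonneg_orthant_iff)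
        then show "(t v* A k \<omega>) $ j \<le> vec (b * l1_norm t) $ j"
          by (simp add: vector_matrix_mult_def l1_norm_eq_sum[OF t] sum_distrib_left mult_ac)
      qed (use laplace_pos[OF o] in \<open>auto simp: less_imp_le\<close>)
      finally show ?thesis using True by simp
    next
      case False
      have "0 \<le> (\<Prod>k=1..N \<omega>. laplace Q Z (t v* A k \<omega>))"
        by (intro prod_nonneg less_imp_le laplace_pos orth)
      with False show ?thesis by simp
    qed
  qed
  moreover have "q * ?L ^ m = (\<integral>\<omega>. ?L ^ m * indicator E \<omega> \<partial>P)"
    by (simp add: q_E sets.Int_space_eq2[OF E])
  ultimately show ?thesis
    unfolding laplace_smoothing(2)[OF t]
    by (simp only:) (intro integral_mono_AE int laplace_smoothing(1)[OF t])
qed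

text \<open>On the diagonal, \<open>g\<close> satisfies the scaling inequality with ratio
  \<open>a * CARD('n)\<close> and therefore grows at least like a power. One further comparison
  passes from the diagonal to arbitrary \<open>t\<close>.\<close>

lemma laplace_upper:
  assumes nz: "\<not> (AE \<omega> in Q. Z \<omega> = 0)"
    and m: "AE \<omega> in P. m \<le> N \<omega>" "2 \<le> m" and a: "0 < a" "a * real CARD('n) < 1"
    and A_ge: "AE \<omega> in P. \<forall>k\<in>{1..m}. \<forall>i j. a \<le> A k \<omega> $ i $ j"
  shows "\<exists>C>0. \<exists>R>0. \<forall>t\<in>nonneg_orthant. l1_norm t \<ge> R \<longrightarrow>
    laplace Q Z t \<le> exp (- C * l1_norm t powr gamma_exponent m CARD('n) a)"
proof -
  define \<gamma> where "\<gamma> = gamma_exponent m CARD('n) a"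
  define g where "g s = - ln (laplace Q Z (vec s))" for s
  let ?c = "a * real CARD('n)"
  have a': "0 < ?c" "?c < 1" using a by auto
  have pos: "0 < laplace Q Z (vec s)" if "0 \<le> s" for s
    using that by (intro laplace_pos vec_in_orthant)
  \<comment> \<open>Stated for general \<open>t\<close> because it serves twice: at
    \<open>t = vec s\<close> it is the scaling inequality, and at arbitrary \<open>t\<close> it is
    the final passage from the diagonal.\<close>
  have ln_step: "m * g (a * l1_norm t) \<le> - ln (laplace Q Z t)" if t: "t \<in> nonneg_orthant" for t
  proof -
    have p: "0 < laplace Q Z (vec (a * l1_norm t))" using a by (intro pos) simp
    have "ln (laplace Q Z t) \<le> ln (laplace Q Z (vec (a * l1_norm t)) ^ m)"
      using p laplace_pos[OF t] laplace_le_power[OF m(1) a(1) A_ge t] by simp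
    then show ?thesis using p by (simp add: g_def ln_realpow)
  qed
  have step: "m * g (?c * s) \<le> g s" if "0 < s" for s
    using ln_step[of "vec s"] that by (simp add: g_def l1_norm_vec vec_in_orthant mult.assoc)
  have g1: "0 < g 1"
    using laplace_less_1[OF nz, of 1] pos[of 1] by (simp add: g_def)
  have bound: "g 1 \<le> g s" if "1 \<le> s" for s
    unfolding g_def using that pos[of 1] pos[of s] laplace_antimono[of "vec 1" "vec s"]
    by (simp add: nonneg_orthant_iff)
  have growth: "g 1 / m * s powr \<gamma> \<le> g s" if "1 \<le> s" for s
    unfolding \<gamma>_def gamma_exponent_def
    by (rule scaling_lower_growth[where g = g, OF a' m(2) step bound less_imp_le[OF g1] that])
  have "laplace Q Z t \<le> exp (- (g 1 * a powr \<gamma>) * l1_norm t powr \<gamma>)"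
    if t: "t \<in> nonneg_orthant" and large: "1 / a \<le> l1_norm t" for t
  proof -
    \<comment> \<open>The factor \<open>m\<close> of the last comparison cancels the
      \<open>1 / m\<close> in \<open>growth\<close>; the threshold \<open>1 / a\<close> ensures
      \<open>a * l1_norm t \<ge> 1\<close>.\<close>
    have "g 1 * a powr \<gamma> * l1_norm t powr \<gamma> = m * (g 1 / m * (a * l1_norm t) powr \<gamma>)"
      using a m by (simp add: powr_mult)
    also have "\<dots> \<le> m * g (a * l1_norm t)"
      using large a by (intro mult_left_mono growth) (auto simp: field_simps)
    also have "\<dots> \<le> - ln (laplace Q Z t)" by (rule ln_step[OF t])
    finally have "ln (laplace Q Z t) \<le> - (g 1 * a powr \<gamma>) * l1_norm t powr \<gamma>" by simp
    then have "exp (ln (laplace Q Z t)) \<le> exp (- (g 1 * a powr \<gamma>) * l1_norm t powr \<gamma>)"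
      by (simp only: exp_le_cancel_iff)
    then show ?thesis using laplace_pos[OF t] by simp
  qed
  moreover have "0 < g 1 * a powr \<gamma>" "0 < 1 / a" using g1 a by auto
  ultimately show ?thesis unfolding \<gamma>_def by blast
qed

text \<open>The scaling inequality bounds the growth of \<open>g\<close> on the diagonal from above.
  This suffices, since each \<open>t\<close> is dominated coordinatewise by
  \<open>vec (l1_norm t)\<close> and the transform is decreasing.\<close>

lemma laplace_lower:
  assumes m: "2 \<le> m" and b: "0 < b" "b * real CARD('n) < 1"
    and q: "0 < measure P {\<omega>\<in>space P. N \<omega> = m \<and> (\<forall>k\<in>{1..m}. \<forall>i j. A k \<omega> $ i $ j \<le> b)}"
  shows "\<exists>C>0. \<exists>R>0. \<forall>t\<in>nonneg_orthant. l1_norm t \<ge> R \<longrightarrow>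
    exp (- C * l1_norm t powr gamma_exponent m CARD('n) b) \<le> laplace Q Z t"
proof -
  define \<gamma> where "\<gamma> = gamma_exponent m CARD('n) b"
  define p where "p = measure P {\<omega>\<in>space P. N \<omega> = m \<and> (\<forall>k\<in>{1..m}. \<forall>i j. A k \<omega> $ i $ j \<le> b)}"
  define K where "K = - ln p"
  \<comment> \<open>adding \<open>K\<close> absorbs the factor \<open>p\<close>, as \<open>2 * K \<le> m * K\<close>\<close>
  define g where "g s = K - ln (laplace Q Z (vec s))" for s
  let ?c = "b * real CARD('n)"
  have b': "0 < ?c" "?c < 1" using b by auto
  have p: "0 < p" "p \<le> 1" using q by (auto simp: p_def)
  then have K: "0 \<le> K" by (simp add: K_def)
  have pos: "0 < laplace Q Z (vec s)" if "0 \<le> s" for s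
    using that by (intro laplace_pos vec_in_orthant)
  have step: "g s \<le> m * g (?c * s)" if s: "0 < s" for s
  proof -
    have L: "0 < laplace Q Z (vec (?c * s))" using s b by (intro pos) simp
    have "p * laplace Q Z (vec (?c * s)) ^ m \<le> laplace Q Z (vec s)"
      using laplace_ge_power[of m b "vec s"] q b s
      by (simp add: p_def l1_norm_vec vec_in_orthant mult.assoc)
    then have "ln (p * laplace Q Z (vec (?c * s)) ^ m) \<le> ln (laplace Q Z (vec s))"
      using L p pos[of s] s by simp
    \<comment> \<open>One \<open>K\<close> comes from the shift in \<open>g\<close>, the other from
      \<open>- ln p\<close>.\<close>
    then have "g s \<le> 2 * K - m * ln (laplace Q Z (vec (?c * s)))"
      using L p by (simp add: g_def K_def ln_mult ln_realpow)
    also have "2 * K \<le> m * K" using m K by (intro mult_right_mono) auto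
    finally show ?thesis by (simp add: g_def right_diff_distrib)
  qed
  have g1: "0 \<le> g 1"
    unfolding g_def
    using laplace_le_1[OF vec_in_orthant[of 1]] ln_le_zero_iff[OF pos[of 1]] K by linarith
  \<comment> \<open>Only \<open>0 \<le> g 1\<close> is known here; the added 1 makes the final
    constant \<open>C\<close> strictly positive.\<close>
  have bound: "g s \<le> g 1 + 1" if "0 < s" "s \<le> 1" for s
  proof -
    have "ln (laplace Q Z (vec 1)) \<le> ln (laplace Q Z (vec s))"
      using that pos[of 1] pos[of s] laplace_antimono[of "vec s" "vec 1"]
      by (simp add: nonneg_orthant_iff)
    then show ?thesis by (simp add: g_def)
  qed
  have growth: "g s \<le> m * (g 1 + 1) * s powr \<gamma>" if "1 \<le> s" for s
    unfolding \<gamma>_def gamma_exponent_def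
    by (rule scaling_upper_growth[where g = g, OF b' m step bound add_nonneg_nonneg[OF g1 zero_le_one] that])
  have "exp (- (m * (g 1 + 1)) * l1_norm t powr \<gamma>) \<le> laplace Q Z t"
    if t: "t \<in> nonneg_orthant" and large: "1 \<le> l1_norm t" for t
  proof -
    have "t $ j \<le> l1_norm t" for j
      using t unfolding l1_norm_eq_sum[OF t] by (intro member_le_sum) (auto simp: nonneg_orthant_iff)
    then have "laplace Q Z (vec (l1_norm t)) \<le> laplace Q Z t"
      by (intro laplace_antimono t) simp
    moreover have "- (m * (g 1 + 1)) * l1_norm t powr \<gamma> \<le> ln (laplace Q Z (vec (l1_norm t)))"
      using growth[OF large] K by (simp add: g_def)
    then have "exp (- (m * (g 1 + 1)) * l1_norm t powr \<gamma>) \<le> laplace Q Z (vec (l1_norm t))"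
      by (subst (asm) ln_ge_iff) (auto intro: pos)
    ultimately show ?thesis by linarith
  qed
  moreover have "0 < m * (g 1 + 1)" using m g1 by simp
  ultimately show ?thesis unfolding \<gamma>_def using zero_less_one by blast
qed

end

section \<open>Small-ball probabilities in a fixed direction\<close>

context nonneg_random_vector
begin

lemma laplace_scaleR: "laplace Q Z (s *\<^sub>R y) = expectation (\<lambda>\<omega>. exp (- (s * (y \<bullet> Z \<omega>))))"
  by (simp add: laplace_def)

text \<open>Along the ray through \<open>y\<close> the l1 norm is \<open>s * l1_norm y\<close>, so
  the bound on the transform becomes one for the scalar variable \<open>y \<bullet> Z\<close>, with
  constant \<open>C * l1_norm y powr \<gamma>\<close> and threshold
  \<open>R / l1_norm y\<close>.\<close>

lemma small_ball_upper:
  assumes \<gamma>: "0 < \<gamma>" "\<gamma> < 1" and y: "y \<in> nonneg_orthant" "y \<noteq> 0"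
    and L: "\<exists>C>0. \<exists>R>0. \<forall>t\<in>nonneg_orthant. l1_norm t \<ge> R \<longrightarrow>
      laplace Q Z t \<le> exp (- C * l1_norm t powr \<gamma>)"
  shows "\<exists>K>0. \<forall>\<^sub>F x in at_right 0.
    prob {\<omega>\<in>space Q. y \<bullet> Z \<omega> \<le> x} \<le> exp (- K * x powr (- \<gamma> / (1 - \<gamma>)))"
proof -
  obtain C R where C: "0 < C" and "0 < R" and
    bound: "\<And>t. t \<in> nonneg_orthant \<Longrightarrow> R \<le> l1_norm t \<Longrightarrow> laplace Q Z t \<le> exp (- C * l1_norm t powr \<gamma>)"
    using L by blast
  have ly: "0 < l1_norm y" using y by (simp add: l1_norm_pos)
  show ?thesis
  proof (rule small_ball_upper_of_laplace[OF _ inner_AE_nonneg[OF y(1)] _ \<gamma>])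
    show "0 < C * l1_norm y powr \<gamma>" using C ly by simp
    fix s assume s: "R / l1_norm y \<le> s"
    have s0: "0 \<le> s" using s \<open>0 < R\<close> ly by (meson divide_nonneg_pos less_imp_le order_trans)
    have "laplace Q Z (s *\<^sub>R y) \<le> exp (- C * l1_norm (s *\<^sub>R y) powr \<gamma>)"
      using s s0 ly y by (intro bound) (auto simp: nonneg_orthant_iff l1_norm_scaleR field_simps)
    then show "expectation (\<lambda>\<omega>. exp (- (s * (y \<bullet> Z \<omega>)))) \<le> exp (- (C * l1_norm y powr \<gamma>) * s powr \<gamma>)"
      using s0 ly by (simp add: laplace_scaleR l1_norm_scaleR powr_mult mult_ac)
  qed simp
qed

lemma small_ball_lower:
  assumes \<gamma>: "0 < \<gamma>" "\<gamma> < 1" and y: "y \<in> nonneg_orthant"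
    and L: "\<exists>C>0. \<exists>R>0. \<forall>t\<in>nonneg_orthant. l1_norm t \<ge> R \<longrightarrow>
      exp (- C * l1_norm t powr \<gamma>) \<le> laplace Q Z t"
  shows "\<exists>K>0. \<forall>\<^sub>F x in at_right 0.
    exp (- K * x powr (- \<gamma> / (1 - \<gamma>))) \<le> prob {\<omega>\<in>space Q. y \<bullet> Z \<omega> \<le> x}"
proof (cases "y = 0")
  case True
  \<comment> \<open>The ray degenerates for \<open>y = 0\<close>, but then the event is the whole
    space for every \<open>x > 0\<close>, so \<open>K = 1\<close> works.\<close>
  have "\<forall>\<^sub>F x::real in at_right 0. 0 < x" by (rule eventually_at_right_less)
  then have "\<forall>\<^sub>F x in at_right 0.
    exp (- 1 * x powr (- \<gamma> / (1 - \<gamma>))) \<le> prob {\<omega>\<in>space Q. y \<bullet> Z \<omega> \<le> x}"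
    by eventually_elim (simp add: True prob_space)
  then show ?thesis using zero_less_one by blast
next
  case False
  obtain C R where C: "0 < C" and "0 < R" and
    bound: "\<And>t. t \<in> nonneg_orthant \<Longrightarrow> R \<le> l1_norm t \<Longrightarrow> exp (- C * l1_norm t powr \<gamma>) \<le> laplace Q Z t"
    using L by blast
  have ly: "0 < l1_norm y" using False by (rule l1_norm_pos)
  show ?thesis
  proof (rule small_ball_lower_of_laplace[OF _ inner_AE_nonneg[OF y] _ \<gamma>])
    show "0 < C * l1_norm y powr \<gamma>" using C ly by simp
    fix s assume s: "R / l1_norm y \<le> s"
    have s0: "0 \<le> s" using s \<open>0 < R\<close> ly by (meson divide_nonneg_pos less_imp_le order_trans)
    have "exp (- C * l1_norm (s *\<^sub>R y) powr \<gamma>) \<le> laplace Q Z (s *\<^sub>R y)"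
      using s s0 ly y by (intro bound) (auto simp: nonneg_orthant_iff l1_norm_scaleR field_simps)
    then show "exp (- (C * l1_norm y powr \<gamma>) * s powr \<gamma>) \<le> expectation (\<lambda>\<omega>. exp (- (s * (y \<bullet> Z \<omega>))))"
      using s0 ly by (simp add: laplace_scaleR l1_norm_scaleR powr_mult mult_ac)
  qed simp
qed

end

section \<open>Range of the exponent and the degenerate case\<close>

text \<open>With \<open>c = b * p\<close>, the hypothesis \<open>c * m \<le> 1\<close> says
  \<open>ln m \<le> - ln c\<close>, so the quotient is at most 1, and strictness carries over. As
  \<open>m \<ge> 2\<close>, it also forces \<open>c \<le> 1 / 2\<close>.\<close>

lemma gamma_exponent_bounds:
  assumes m: "2 \<le> m" and p: "0 < p" and b: "0 < b" and le: "b * real p * real m \<le> 1"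
  shows "b * real p < 1" "0 < gamma_exponent m p b" "gamma_exponent m p b \<le> 1"
    and "gamma_exponent m p b < 1 \<longleftrightarrow> b * real p * real m < 1"
proof -
  have c: "0 < b * real p" using b p by simp
  have "b * real p * 2 \<le> b * real p * real m" using c m by (intro mult_left_mono) linarith+
  then show c1: "b * real p < 1" using le c by linarith
  have ln0: "ln (b * real p) < 0" using c c1 by simp
  have lnm: "0 < ln (real m)" using m by simp
  have *: "ln (b * real p * real m) = ln (b * real p) + ln (real m)"
    using m by (intro ln_mult_pos c) simp
  have \<gamma>: "gamma_exponent m p b = ln (real m) / - ln (b * real p)"
    by (simp add: gamma_exponent_def)
  show "0 < gamma_exponent m p b"
    unfolding \<gamma> using ln0 lnm by (intro divide_pos_pos) auto
  have prod_pos: "0 < b * real p * real m" using m by (intro mult_pos_pos[OF c]) simp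
  have "ln (b * real p * real m) \<le> 0" using le ln_le_zero_iff[OF prod_pos] by blast
  with * have "ln (real m) \<le> - ln (b * real p)" by linarith
  then show "gamma_exponent m p b \<le> 1"
    unfolding \<gamma> using ln0 by (subst divide_le_eq_1_pos) linarith+
  have "gamma_exponent m p b < 1 \<longleftrightarrow> ln (real m) < - ln (b * real p)"
    unfolding \<gamma> using ln0 by (subst divide_less_eq_1_pos) linarith+
  also have "\<dots> \<longleftrightarrow> ln (b * real p * real m) < 0" using * by linarith
  finally show "gamma_exponent m p b < 1 \<longleftrightarrow> b * real p * real m < 1"
    by (simp only: ln_less_zero_iff[OF prod_pos])
qed

text \<open>A \<open>Sup\<close> in \<open>nat\<close> is attained once the set is finite and
  nonempty. Were the set infinite, countably many null sets would combine to make \<open>N\<close>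
  exceed every natural number almost surely.\<close>

lemma AE_ess_inf_nat_le:
  assumes "prob_space P"
  shows "AE \<omega> in P. ess_inf_nat P N \<le> N \<omega>"
proof -
  interpret prob_space P by fact
  let ?S = "{n. AE \<omega> in P. n \<le> N \<omega>}"
  have "finite ?S"
  proof (rule ccontr)
    assume inf: "infinite ?S"
    have "AE \<omega> in P. n \<le> N \<omega>" for n
    proof -
      obtain k where "k \<in> ?S" "n \<le> k" using inf infinite_nat_iff_unbounded_le by blast
      then show ?thesis by (auto elim: eventually_mono)
    qed
    then have "AE \<omega> in P. \<forall>n. n \<le> N \<omega>" by (simp add: AE_all_countable)
    then have "AE \<omega> in P. False" by eventually_elim (use Suc_n_not_le_n in blast)
    then show False by simp
  qed
  moreover have "0 \<in> ?S" by simp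
  ultimately have "Sup ?S \<in> ?S" unfolding Sup_nat_def using Max_in[of ?S] by auto
  then show ?thesis by (simp add: ess_inf_nat_def)
qed

text \<open>Removing \<open>a\<close> from each entry of the first \<open>m\<close> matrices leaves
  nonnegative excesses \<open>d\<close>, whose sum has expectation
  \<open>mean_matrix P N A $ i $ j - m * a\<close>. If this is zero for all entries, every excess
  vanishes almost surely.\<close>

lemma mean_matrix_lower_bound:
  fixes A :: "nat \<Rightarrow> 'w \<Rightarrow> real^'n^'n" and m :: nat
  assumes P: "prob_space P"
    and A_nonneg: "AE \<omega> in P. \<forall>k\<ge>1. \<forall>i j. 0 \<le> A k \<omega> $ i $ j"
    and int: "\<And>i j. integrable P (\<lambda>\<omega>. \<Sum>k=1..N \<omega>. A k \<omega> $ i $ j)"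
    and m: "AE \<omega> in P. m \<le> N \<omega>"
    and A_ge: "AE \<omega> in P. \<forall>k\<in>{1..m}. \<forall>i j. a \<le> A k \<omega> $ i $ j"
  shows "real m * a \<le> mean_matrix P N A $ i $ j"
    and "(\<And>i j. mean_matrix P N A $ i $ j = real m * a) \<Longrightarrow>
      AE \<omega> in P. (\<forall>k\<in>{1..m}. \<forall>i j. A k \<omega> $ i $ j = a) \<and> (\<forall>k\<in>{m<..N \<omega>}. A k \<omega> = 0)"
proof -
  interpret prob_space P by fact
  define d where "d i j k \<omega> = A k \<omega> $ i $ j - (if k \<le> m then a else 0)" for i j k \<omega>
  have d_nonneg: "AE \<omega> in P. \<forall>k\<ge>1. \<forall>i j. 0 \<le> d i j k \<omega>"
    using A_nonneg A_ge by eventually_elim (auto simp: d_def)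
  have sum_d: "AE \<omega> in P. \<forall>i j. (\<Sum>k=1..N \<omega>. d i j k \<omega>) = (\<Sum>k=1..N \<omega>. A k \<omega> $ i $ j) - real m * a"
    using m
  proof eventually_elim
    case (elim \<omega>)
    \<comment> \<open>Because \<open>m \<le> N \<omega>\<close>, the value \<open>a\<close> is
      subtracted exactly \<open>m\<close> times.\<close>
    then have "{1..N \<omega>} \<inter> {k. k \<le> m} = {1..m}" by auto
    then show ?case by (simp add: d_def sum_subtractf sum.If_cases)
  qed
  have excess_nonneg: "AE \<omega> in P. 0 \<le> (\<Sum>k=1..N \<omega>. A k \<omega> $ i $ j) - real m * a" for i j
    using sum_d d_nonneg
  proof eventually_elim
    case (elim \<omega>)
    then have "0 \<le> (\<Sum>k=1..N \<omega>. d i j k \<omega>)" by (intro sum_nonneg) auto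
    then show ?case using elim by simp
  qed
  have excess: "(\<integral>\<omega>. (\<Sum>k=1..N \<omega>. A k \<omega> $ i $ j) - real m * a \<partial>P) = mean_matrix P N A $ i $ j - real m * a"
    for i j using int by (simp add: mean_matrix_def prob_space)
  show "real m * a \<le> mean_matrix P N A $ i $ j"
    using integral_nonneg_AE[OF excess_nonneg[of i j]] unfolding excess by simp
  assume eq: "\<And>i j. mean_matrix P N A $ i $ j = real m * a"
  have "AE \<omega> in P. (\<Sum>k=1..N \<omega>. A k \<omega> $ i $ j) - real m * a = 0" for i j
    using excess[of i j] eq int excess_nonneg[of i j]
    by (subst integral_nonneg_eq_0_iff_AE[symmetric]) auto
  then have "AE \<omega> in P. \<forall>i j. (\<Sum>k=1..N \<omega>. A k \<omega> $ i $ j) - real m * a = 0"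
    by (simp add: AE_all_countable)
  then show "AE \<omega> in P. (\<forall>k\<in>{1..m}. \<forall>i j. A k \<omega> $ i $ j = a) \<and> (\<forall>k\<in>{m<..N \<omega>}. A k \<omega> = 0)"
    using sum_d d_nonneg m
  proof eventually_elim
    case (elim \<omega>)
    have "d i j k \<omega> = 0" if "k \<in> {1..N \<omega>}" for i j k
    proof -
      have "(\<Sum>k=1..N \<omega>. d i j k \<omega>) = 0" using elim by simp
      then show ?thesis
        by (subst (asm) sum_nonneg_eq_0_iff) (use elim that in auto)
    qed
    then have *: "A k \<omega> $ i $ j = (if k \<le> m then a else 0)" if "1 \<le> k" "k \<le> N \<omega>" for i j k
      using that by (simp add: d_def)
    show ?case using elim by (auto simp: * vec_eq_iff)
  qed
qed

text \<open>The value \<open>\<gamma> = 1\<close> can occur: for \<open>N = m\<close> and all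
  entries of the \<open>A k\<close> equal to \<open>1 / (m * p)\<close>, the constant vector of ones
  is a solution. There \<open>1 - \<gamma>\<close> vanishes and the small-ball exponent has no
  meaning, so the conclusion gives \<open>\<gamma> \<le> 1\<close>, describes the equality case, and
  states the small-ball bound for \<open>\<gamma> < 1\<close>.\<close>

theorem theorem2p4:
  fixes P :: "'w measure" and N :: "'w \<Rightarrow> nat" and A :: "nat \<Rightarrow> 'w \<Rightarrow> real^'n^'n"
    and Q :: "'z measure" and Z :: "'z \<Rightarrow> real^'n"
    and m :: nat and a \<gamma> :: real and \<gamma>' :: "real \<Rightarrow> real"
  assumes "prob_space P"
    and "N \<in> measurable P (count_space UNIV)"
    and "\<And>k. k \<ge> 1 \<Longrightarrow> A k \<in> borel_measurable P"
    and "\<And>k. k \<ge> 1 \<Longrightarrow> AE \<omega> in P. \<forall>i j. 0 \<le> A k \<omega> $ i $ j"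
    and "\<And>i j. integrable P (\<lambda>\<omega>. \<Sum>k=1..N \<omega>. A k \<omega> $ i $ j)"
    and "strictly_positive (mean_matrix P N A)"
    and "max_modulus_eigenvalue (mean_matrix P N A) 1"
    and "nontrivial_solution P N A Q Z"
    and "measure P {\<omega>\<in>space P. \<forall>k\<in>{1..N \<omega>}. has_positive_column (A k \<omega>)} > 0"
    and "m = ess_inf_nat P N"
    and "m \<ge> 2"
    and "a > 0"
    and "\<And>k. k \<in> {1..m} \<Longrightarrow> AE \<omega> in P. \<forall>i j. a \<le> A k \<omega> $ i $ j"
    and "\<gamma> = gamma_exponent m CARD('n) a"
    and "\<And>\<epsilon>. \<gamma>' \<epsilon> = gamma_exponent m CARD('n) (a + \<epsilon>)"
  shows
    "(measure P {\<omega>\<in>space P. N \<omega> = m} > 0 \<longrightarrow>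
        0 < \<gamma> \<and> \<gamma> \<le> 1 \<and>
        (\<gamma> = 1 \<longrightarrow> (AE \<omega> in P. (\<forall>k\<in>{1..m}. \<forall>i j. A k \<omega> $ i $ j = a) \<and>
                              (\<forall>k\<in>{m<..N \<omega>}. A k \<omega> = 0))) \<and>
        (\<exists>C>0. \<exists>R>0. \<forall>t\<in>nonneg_orthant. l1_norm t \<ge> R \<longrightarrow>
           laplace Q Z t \<le> exp (- C * l1_norm t powr \<gamma>)) \<and>
        (\<gamma> < 1 \<longrightarrow> (\<forall>y\<in>nonneg_orthant. y \<noteq> 0 \<longrightarrow>
           (\<exists>C>0. \<forall>\<^sub>F x in at_right 0.
              measure Q {\<omega>\<in>space Q. y \<bullet> Z \<omega> \<le> x} \<le> exp (- C * x powr (- \<gamma> / (1 - \<gamma>))))))) \<and>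
     (\<forall>\<epsilon>>0. (a + \<epsilon>) * real CARD('n) * real m < 1 \<longrightarrow>
        measure P {\<omega>\<in>space P. N \<omega> = m \<and> (\<forall>k\<in>{1..m}. \<forall>i j. A k \<omega> $ i $ j \<le> a + \<epsilon>)} > 0 \<longrightarrow>
        0 < \<gamma>' \<epsilon> \<and> \<gamma>' \<epsilon> < 1 \<and>
        (\<exists>C>0. \<exists>R>0. \<forall>t\<in>nonneg_orthant. l1_norm t \<ge> R \<longrightarrow>
           laplace Q Z t \<ge> exp (- C * l1_norm t powr \<gamma>' \<epsilon>)) \<and>
        (\<forall>y\<in>nonneg_orthant.
           (\<exists>C>0. \<forall>\<^sub>F x in at_right 0.
              measure Q {\<omega>\<in>space Q. y \<bullet> Z \<omega> \<le> x} \<ge> exp (- C * x powr (- \<gamma>' \<epsilon> / (1 - \<gamma>' \<epsilon>))))))"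
proof -
  interpret P: prob_space P by (rule assms(1))
  have sol: "is_solution P N A Q Z" and nz: "\<not> (AE \<omega> in Q. Z \<omega> = 0)"
    using assms(8) by (auto simp: nontrivial_solution_def)
  interpret Q: prob_space Q using sol by (simp add: is_solution_def)
  interpret S: smoothing_solution Q Z P N A
    using sol assms(2-4) by unfold_locales (auto simp: is_solution_def)
  let ?p = "CARD('n)"
  have m: "AE \<omega> in P. m \<le> N \<omega>" using AE_ess_inf_nat_le[OF assms(1), of N] assms(10) by simp
  have m2: "2 \<le> m" and a: "0 < a" by fact+
  have A_ge: "AE \<omega> in P. \<forall>k\<in>{1..m}. \<forall>i j. a \<le> A k \<omega> $ i $ j"
    using assms(13) by (intro AE_finite_allI) auto
  note M = mean_matrix_lower_bound[OF assms(1) S.A_nonneg assms(5) m A_ge]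
  have ma: "0 < real m * a" using m2 a by simp
  note perron = max_eigenvalue_one_entry_bound[OF assms(7) ma M(1)]
  have amp: "a * real ?p * real m \<le> 1" using perron(1) by (simp add: mult_ac)
  note gb = gamma_exponent_bounds[OF m2 zero_less_card_finite a amp, folded assms(14)]
  \<comment> \<open>\<open>\<gamma> = 1\<close> means \<open>a * p * m = 1\<close>, the equality
    case of the eigenvalue bound, so every entry of the mean matrix equals
    \<open>m * a\<close>.\<close>
  have deg: "AE \<omega> in P. (\<forall>k\<in>{1..m}. \<forall>i j. A k \<omega> $ i $ j = a) \<and> (\<forall>k\<in>{m<..N \<omega>}. A k \<omega> = 0)"
    if "\<gamma> = 1"
  proof (rule M(2))
    have "real m * a * real ?p = 1" using gb(4) amp that by (simp add: mult_ac)
    then show "mean_matrix P N A $ i $ j = real m * a" for i j by (rule perron(2))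
  qed
  have up: "\<exists>C>0. \<exists>R>0. \<forall>t\<in>nonneg_orthant. l1_norm t \<ge> R \<longrightarrow>
      laplace Q Z t \<le> exp (- C * l1_norm t powr \<gamma>)"
    unfolding assms(14) by (rule S.laplace_upper[OF nz m m2 a gb(1) A_ge])
  have lower: "0 < \<gamma>' \<epsilon> \<and> \<gamma>' \<epsilon> < 1 \<and>
        (\<exists>C>0. \<exists>R>0. \<forall>t\<in>nonneg_orthant. l1_norm t \<ge> R \<longrightarrow>
           laplace Q Z t \<ge> exp (- C * l1_norm t powr \<gamma>' \<epsilon>)) \<and>
        (\<forall>y\<in>nonneg_orthant.
           (\<exists>C>0. \<forall>\<^sub>F x in at_right 0.
              measure Q {\<omega>\<in>space Q. y \<bullet> Z \<omega> \<le> x} \<ge> exp (- C * x powr (- \<gamma>' \<epsilon> / (1 - \<gamma>' \<epsilon>)))))"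
    if e: "\<epsilon> > 0" "(a + \<epsilon>) * real ?p * real m < 1"
      and q: "measure P {\<omega>\<in>space P. N \<omega> = m \<and> (\<forall>k\<in>{1..m}. \<forall>i j. A k \<omega> $ i $ j \<le> a + \<epsilon>)} > 0"
    for \<epsilon>
  proof -
    have b: "0 < a + \<epsilon>" using a e by simp
    note gb' = gamma_exponent_bounds[OF m2 zero_less_card_finite b less_imp_le[OF e(2)]]
    have g: "0 < \<gamma>' \<epsilon>" "\<gamma>' \<epsilon> < 1" using gb'(2,4) e(2) by (simp_all add: assms(15))
    have lo: "\<exists>C>0. \<exists>R>0. \<forall>t\<in>nonneg_orthant. l1_norm t \<ge> R \<longrightarrow>
        exp (- C * l1_norm t powr \<gamma>' \<epsilon>) \<le> laplace Q Z t"
      unfolding assms(15) by (rule S.laplace_lower[OF m2 b gb'(1) q])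
    show ?thesis using g lo S.small_ball_lower[OF g _ lo] by blast
  qed
  have ball: "\<gamma> < 1 \<longrightarrow> (\<forall>y\<in>nonneg_orthant. y \<noteq> 0 \<longrightarrow>
      (\<exists>C>0. \<forall>\<^sub>F x in at_right 0.
        measure Q {\<omega>\<in>space Q. y \<bullet> Z \<omega> \<le> x} \<le> exp (- C * x powr (- \<gamma> / (1 - \<gamma>)))))"
    by (intro impI ballI, rule S.small_ball_upper[OF gb(2) _ _ _ up])
  show ?thesis
  proof (rule conjI, goal_cases)
    case 1
    show ?case by (rule impI, intro conjI gb(2,3) up ball, rule impI, rule deg)
  next
    case 2
    show ?case by (intro allI impI, rule lower)
  qed
qed

end
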